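(* For $i=1,2$ let $(B_i,C_i)$ and $(X_i,A_i)$ be CW pairs and let $f_i\colon (B_i,C_i)\to (X_i,A_i)$ be a map of pairs, such that $B_1\times B_2$ is a normal space. Then, for the map of pairs $$f_1\times f_2\colon (B_1\times B_2,\ C_1\times C_2)\to (X_1\times X_2,\ A_1\times A_2),$$ one has $\operatorname{srelcat}(f_1\times f_2)\le \operatorname{srelcat}(f_1)+\operatorname{srelcat}(f_2)$.
   Context: All maps are continuous and $I=[0,1]$. A map of pairs $g\colon (B,C)\to (X,A)$ is strongly relatively inessential if there is a homotopy $H\colon B\times I\to X$ such that $H(-,1)=g$, $H(B,0)\subseteq A$, and $H(c,t)=g(c)\in A$ for all $c\in C$ and $t\in I$. Strong relative category of a map: for a map of pairs $f\colon (B,C)\to (X,A)$, $\operatorname{srelcat}(f)$ is the least non-negative integer $\ell$ such that $B$ has an open cover $\{B_0,\dots,B_\ell\}$ for which each restriction $f|_{B_i}\colon (B_i,B_i\cap C)\to (X,A)$ is strongly relatively inessential. If no such $\ell$ exists, $\operatorname{srelcat}(f)=\infty$. *)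

theory Defs
  imports "HOL-Analysis.Analysis" "HOL-Library.Extended_Nat"
begin

text \<open>CW complexes in the sense of J. H. C. Whitehead: a Hausdorff space partitioned into open
  cells, each with a characteristic map, subject to closure-finiteness and the weak topology.
  The unit n-ball lives in the library's \<open>Euclidean_space n\<close>; for n = 0 it is a single point which
  is also the open ball, and the boundary sphere is empty.\<close>

definition unit_cball :: "nat \<Rightarrow> (nat \<Rightarrow> real) set" where
  "unit_cball n = {x \<in> topspace (Euclidean_space n). (\<Sum>i<n. (x i)\<^sup>2) \<le> 1}"

definition unit_oball :: "nat \<Rightarrow> (nat \<Rightarrow> real) set" where
  "unit_oball n = {x \<in> topspace (Euclidean_space n). (\<Sum>i<n. (x i)\<^sup>2) < 1}"

definition unit_sphere :: "nat \<Rightarrow> (nat \<Rightarrow> real) set" where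
  "unit_sphere n = {x \<in> topspace (Euclidean_space n). (\<Sum>i<n. (x i)\<^sup>2) = 1}"

text \<open>Here \<open>E\<close> is the set of open cells and \<open>d e\<close> is the dimension of the cell \<open>e\<close>; the dimensions
  need not be bounded and \<open>E\<close> may be infinite.\<close>

definition CW_structure :: "'a topology \<Rightarrow> 'a set set \<Rightarrow> ('a set \<Rightarrow> nat) \<Rightarrow> bool" where
  "CW_structure X E d \<longleftrightarrow>
     Hausdorff_space X \<and>
     \<Union>E = topspace X \<and> pairwise disjnt E \<and>
     (\<forall>e\<in>E. \<exists>\<phi>.
        continuous_map (subtopology (Euclidean_space (d e)) (unit_cball (d e))) X \<phi> \<and>
        homeomorphic_map (subtopology (Euclidean_space (d e)) (unit_oball (d e)))
                         (subtopology X e) \<phi> \<and>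
        (\<exists>F. finite F \<and> F \<subseteq> {e'\<in>E. d e' < d e} \<and> \<phi> ` unit_sphere (d e) \<subseteq> \<Union>F)) \<and>
     (\<forall>S. S \<subseteq> topspace X \<longrightarrow>
        (closedin X S \<longleftrightarrow> (\<forall>e\<in>E. closedin X (S \<inter> X closure_of e))))"

text \<open>\<open>X\<close> is a CW complex and \<open>A\<close> is a subcomplex: a union of cells that contains the closure
  of each of these cells.\<close>

definition CW_pair :: "'a topology \<Rightarrow> 'a set \<Rightarrow> bool" where
  "CW_pair X A \<longleftrightarrow>
     (\<exists>E d. CW_structure X E d \<and>
        (\<exists>F\<subseteq>E. A = \<Union>F \<and> (\<forall>e\<in>F. X closure_of e \<subseteq> A)))"

definition map_of_pairs ::
  "'a topology \<Rightarrow> 'a set \<Rightarrow> 'b topology \<Rightarrow> 'b set \<Rightarrow> ('a \<Rightarrow> 'b) \<Rightarrow> bool" where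
  "map_of_pairs B C X A f \<longleftrightarrow> continuous_map B X f \<and> f ` C \<subseteq> A"

definition strongly_relatively_inessential ::
  "'a topology \<Rightarrow> 'a set \<Rightarrow> 'b topology \<Rightarrow> 'b set \<Rightarrow> ('a \<Rightarrow> 'b) \<Rightarrow> bool" where
  "strongly_relatively_inessential B C X A g \<longleftrightarrow>
     (\<exists>H. continuous_map (prod_topology B (top_of_set {0..1::real})) X H \<and>
        (\<forall>b\<in>topspace B. H (b, 1) = g b) \<and>
        (\<forall>b\<in>topspace B. H (b, 0) \<in> A) \<and>
        (\<forall>c\<in>C. \<forall>t\<in>{0..1}. H (c, t) = g c \<and> g c \<in> A))"

text \<open>\<open>B\<close> has an open cover by \<open>l + 1\<close> sets \<open>U 0, ..., U l\<close>, on each of which the restriction of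
  \<open>f\<close> is strongly relatively inessential.\<close>

definition srel_cover ::
  "'a topology \<Rightarrow> 'a set \<Rightarrow> 'b topology \<Rightarrow> 'b set \<Rightarrow> ('a \<Rightarrow> 'b) \<Rightarrow> nat \<Rightarrow> bool" where
  "srel_cover B C X A f l \<longleftrightarrow>
     (\<exists>U :: nat \<Rightarrow> 'a set. (\<forall>i\<le>l. openin B (U i)) \<and> (\<Union>i\<le>l. U i) = topspace B \<and>
        (\<forall>i\<le>l. strongly_relatively_inessential (subtopology B (U i)) (U i \<inter> C) X A f))"

definition srelcat ::
  "'a topology \<Rightarrow> 'a set \<Rightarrow> 'b topology \<Rightarrow> 'b set \<Rightarrow> ('a \<Rightarrow> 'b) \<Rightarrow> enat" where
  "srelcat B C X A f =
     (if \<exists>l. srel_cover B C X A f l then enat (LEAST l. srel_cover B C X A f l) else \<infinity>)"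

end

theory Submission
  imports Defs
begin

text \<open>Refine finite open covers \<open>U\<close> of \<open>B\<^sub>1\<close> and \<open>V\<close> of \<open>B\<^sub>2\<close> by the cozero sets of continuous
  functions \<open>\<phi>\<^sub>i, \<psi>\<^sub>j \<ge> 0\<close>. A point \<open>x\<close> lays out consecutive intervals of lengths \<open>\<phi>\<^sub>i x\<close> on the half
  line starting at \<open>0\<close>, and \<open>y\<close> likewise with lengths \<open>\<psi>\<^sub>j y\<close>. Let \<open>W i j\<close> be the open set of those
  \<open>(x, y)\<close> for which the \<open>i\<close>-th interval of \<open>x\<close> overlaps the \<open>j\<close>-th interval of \<open>y\<close>; it is contained
  in \<open>U i \<times> V j\<close>. These sets cover, since the first nondegenerate intervals of \<open>x\<close> and \<open>y\<close> both start
  at \<open>0\<close>. Those with a fixed \<open>i + j\<close> are disjoint, since increasing \<open>i\<close> moves one interval to the right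
  while decreasing \<open>j\<close> moves the other one to the left. So the product homotopies paste on the union
  of the \<open>W i j\<close> with \<open>i + j = k\<close>, for each \<open>k \<le> m + n\<close>.\<close>

section \<open>Cozero refinements of finite open covers\<close>

text \<open>The sets \<open>U i\<close> are exchanged for cozero sets one at a time, each exchange
  by one Urysohn function. Since the cover is finite, no local finiteness argument is
  involved.\<close>

lemma normal_space_finite_cover_cozero:
  fixes U :: "nat \<Rightarrow> 'a set"
  assumes X: "normal_space X"
    and U: "\<And>i. i < n \<Longrightarrow> openin X (U i)" and cov: "topspace X \<subseteq> (\<Union>i<n. U i)"
  obtains \<phi> :: "nat \<Rightarrow> 'a \<Rightarrow> real"
  where "\<And>i. i < n \<Longrightarrow> continuous_map X euclideanreal (\<phi> i)"
    and "\<And>i x. i < n \<Longrightarrow> x \<in> topspace X \<Longrightarrow> 0 \<le> \<phi> i x"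
    and "\<And>i x. i < n \<Longrightarrow> x \<in> topspace X \<Longrightarrow> 0 < \<phi> i x \<Longrightarrow> x \<in> U i"
    and "\<And>x. x \<in> topspace X \<Longrightarrow> \<exists>i<n. 0 < \<phi> i x"
proof -
  \<comment> \<open>Invariant after \<open>k\<close> exchanges: the first \<open>k\<close> cozero
    sets together with the untouched \<open>U k\<close>, ..., \<open>U (n - 1)\<close> still
    cover.\<close>
  have "\<exists>\<phi> :: nat \<Rightarrow> 'a \<Rightarrow> real.
      (\<forall>i<k. continuous_map X euclideanreal (\<phi> i)) \<and>
      (\<forall>i<k. \<forall>x\<in>topspace X. 0 \<le> \<phi> i x \<and> (0 < \<phi> i x \<longrightarrow> x \<in> U i)) \<and>
      (\<forall>x\<in>topspace X. (\<exists>i<k. 0 < \<phi> i x) \<or> (\<exists>i\<in>{k..<n}. x \<in> U i))"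
    if "k \<le> n" for k
    using that
  proof (induction k)
    case 0
    then show ?case using cov by (fastforce simp: subset_iff)
  next
    case (Suc k)
    have "k \<le> n" using Suc.prems by simp
    from Suc.IH[OF this] obtain \<phi> :: "nat \<Rightarrow> 'a \<Rightarrow> real"
      where c: "\<And>i. i < k \<Longrightarrow> continuous_map X euclideanreal (\<phi> i)"
        and s: "\<And>i x. i < k \<Longrightarrow> x \<in> topspace X \<Longrightarrow> 0 \<le> \<phi> i x \<and> (0 < \<phi> i x \<longrightarrow> x \<in> U i)"
        and p: "\<And>x. x \<in> topspace X \<Longrightarrow> (\<exists>i<k. 0 < \<phi> i x) \<or> (\<exists>i\<in>{k..<n}. x \<in> U i)"
      by blast
    \<comment> \<open>\<open>P\<close> is what stays covered without \<open>U k\<close>, so the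
      complements of \<open>P\<close> and \<open>U k\<close> are disjoint. A Urysohn function that
      is 0 off \<open>U k\<close> and 1 off \<open>P\<close> is therefore positive only inside
      \<open>U k\<close>, and positive wherever \<open>P\<close> fails to cover.\<close>
    define P where "P = (\<Union>i<k. {x \<in> topspace X. \<phi> i x \<in> {0<..}}) \<union> (\<Union>i\<in>{Suc k..<n}. U i)"
    have "openin X P"
      unfolding P_def using U openin_continuous_map_preimage[OF c, of _ "{0<..}"]
      by (intro openin_Un openin_Union) auto
    then have P: "closedin X (topspace X - P)" by blast
    have k: "closedin X (topspace X - U k)" using U Suc.prems by auto
    have "{k..<n} = insert k {Suc k..<n}" using Suc.prems by auto
    with p have "disjnt (topspace X - U k) (topspace X - P)"
      by (fastforce simp: P_def disjnt_iff)
    from Urysohn_lemma[OF X k P this zero_le_one]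
    obtain f where f: "continuous_map X (top_of_set {0..1::real}) f"
      "f ` (topspace X - U k) \<subseteq> {0}" "f ` (topspace X - P) \<subseteq> {1}" by blast
    have f01: "0 \<le> f x" if "x \<in> topspace X" for x
      using f(1) that by (auto simp: continuous_map_in_subtopology Pi_iff)
    have fk: "x \<in> U k" if "x \<in> topspace X" "0 < f x" for x
      using f(2) that by force
    have fP: "0 < f x \<or> x \<in> P" if "x \<in> topspace X" for x
      using f(3) that by force
    have 1: "continuous_map X euclideanreal ((\<phi>(k := f)) i)" if "i < Suc k" for i
      using c f(1) that by (auto simp: less_Suc_eq continuous_map_in_subtopology)
    have 2: "0 \<le> (\<phi>(k := f)) i x \<and> (0 < (\<phi>(k := f)) i x \<longrightarrow> x \<in> U i)"
      if "i < Suc k" "x \<in> topspace X" for i x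
      using s f01 fk that by (auto simp: less_Suc_eq)
    have 3: "(\<exists>i<Suc k. 0 < (\<phi>(k := f)) i x) \<or> (\<exists>i\<in>{Suc k..<n}. x \<in> U i)"
      if x: "x \<in> topspace X" for x
    proof (cases "0 < f x")
      case True
      then show ?thesis by (intro disjI1 exI[of _ k]) simp
    next
      case False
      then have "x \<in> P" using fP x by blast
      then show ?thesis
      proof (unfold P_def, elim UnE UN_E)
        fix i assume "i \<in> {..<k}" "x \<in> {x \<in> topspace X. \<phi> i x \<in> {0<..}}"
        then show ?thesis by (intro disjI1 exI[of _ i]) simp
      qed blast
    qed
    show ?case
      by (intro exI[of _ "\<phi>(k := f)"] conjI allI impI ballI 1 3) (use 2 in auto)
  qed
  from this[OF order_refl] that show ?thesis
    by auto metis
qed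

section \<open>Restrictions, products and disjoint unions of homotopies\<close>

lemma strongly_relatively_inessential_subtopology:
  assumes "strongly_relatively_inessential B C X A g" and "D \<subseteq> C"
  shows "strongly_relatively_inessential (subtopology B S) D X A g"
proof -
  have "continuous_map (prod_topology (subtopology B S) T) X H"
    if "continuous_map (prod_topology B T) X H" for T :: "real topology" and H
    using continuous_map_from_subtopology[OF that, of "S \<times> UNIV"]
    by (simp add: subtopology_Times)
  with assms show ?thesis
    unfolding strongly_relatively_inessential_def by (auto simp: subset_iff) blast
qed

text \<open>Both homotopies run simultaneously with the same time parameter. Over
  \<open>C1 \<times> C2\<close> both coordinates stand still, so the pair does too.\<close>

lemma strongly_relatively_inessential_prod:
  assumes "strongly_relatively_inessential B1 C1 X1 A1 g1"
    and "strongly_relatively_inessential B2 C2 X2 A2 g2"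
  shows "strongly_relatively_inessential (prod_topology B1 B2) (C1 \<times> C2)
           (prod_topology X1 X2) (A1 \<times> A2) (map_prod g1 g2)"
proof -
  let ?I = "top_of_set {0..1::real}"
  obtain H where H: "continuous_map (prod_topology B1 ?I) X1 H"
      "\<And>b. b \<in> topspace B1 \<Longrightarrow> H (b, 1) = g1 b \<and> H (b, 0) \<in> A1"
      "\<And>c t. c \<in> C1 \<Longrightarrow> t \<in> {0..1} \<Longrightarrow> H (c, t) = g1 c \<and> g1 c \<in> A1"
    using assms(1) unfolding strongly_relatively_inessential_def by blast
  obtain K where K: "continuous_map (prod_topology B2 ?I) X2 K"
      "\<And>b. b \<in> topspace B2 \<Longrightarrow> K (b, 1) = g2 b \<and> K (b, 0) \<in> A2"
      "\<And>c t. c \<in> C2 \<Longrightarrow> t \<in> {0..1} \<Longrightarrow> K (c, t) = g2 c \<and> g2 c \<in> A2"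
    using assms(2) unfolding strongly_relatively_inessential_def by blast
  have fs: "continuous_map (prod_topology (prod_topology B1 B2) ?I) B1 (\<lambda>p. fst (fst p))"
    "continuous_map (prod_topology (prod_topology B1 B2) ?I) B2 (\<lambda>p. snd (fst p))"
    using continuous_map_compose[OF continuous_map_fst continuous_map_fst]
      continuous_map_compose[OF continuous_map_fst continuous_map_snd]
    unfolding o_def by blast+
  have "continuous_map (prod_topology (prod_topology B1 B2) ?I) (prod_topology X1 X2)
     (\<lambda>p. ((H \<circ> (\<lambda>p. (fst (fst p), snd p))) p, (K \<circ> (\<lambda>p. (snd (fst p), snd p))) p))"
    by (intro continuous_map_paired[THEN iffD2] conjI continuous_map_compose[OF _ H(1)]
        continuous_map_compose[OF _ K(1)] fs continuous_map_snd)
  with H K show ?thesis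
    unfolding strongly_relatively_inessential_def
    by (intro exI conjI) (assumption | force)+
qed

text \<open>The cylinders over the \<open>W i\<close> are open and pairwise disjoint, so the chosen
  homotopies have no overlaps on which to agree and paste to a continuous map. This lets many sets
  count as a single member of a cover.\<close>

lemma strongly_relatively_inessential_disjoint_Union:
  assumes W: "\<And>i. i \<in> I \<Longrightarrow> openin B (W i)" and dis: "disjoint_family_on W I"
    and g: "\<And>i. i \<in> I \<Longrightarrow> strongly_relatively_inessential (subtopology B (W i)) (W i \<inter> C) X A g"
  shows "strongly_relatively_inessential (subtopology B (\<Union>i\<in>I. W i)) ((\<Union>i\<in>I. W i) \<inter> C) X A g"
proof -
  let ?J = "top_of_set {0..1::real}" and ?V = "\<Union>i\<in>I. W i"
  have sub: "W i \<subseteq> topspace B" if "i \<in> I" for i using W that openin_subset by blast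
  obtain H where H: "\<And>i. i \<in> I \<Longrightarrow> continuous_map (prod_topology (subtopology B (W i)) ?J) X (H i)"
      "\<And>i b. i \<in> I \<Longrightarrow> b \<in> W i \<Longrightarrow> H i (b, 1) = g b \<and> H i (b, 0) \<in> A"
      "\<And>i c t. i \<in> I \<Longrightarrow> c \<in> W i \<Longrightarrow> c \<in> C \<Longrightarrow> t \<in> {0..1} \<Longrightarrow> H i (c, t) = g c \<and> g c \<in> A"
  proof -
    have "\<exists>H. \<forall>i\<in>I. continuous_map (prod_topology (subtopology B (W i)) ?J) X (H i) \<and>
        (\<forall>b\<in>W i. H i (b, 1) = g b \<and> H i (b, 0) \<in> A) \<and>
        (\<forall>c\<in>W i \<inter> C. \<forall>t\<in>{0..1}. H i (c, t) = g c \<and> g c \<in> A)"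
    proof (rule bchoice, rule ballI)
      fix i assume i: "i \<in> I"
      have "topspace (subtopology B (W i)) = W i" using sub[OF i] by auto
      with g[OF i] show "\<exists>H. continuous_map (prod_topology (subtopology B (W i)) ?J) X H \<and>
        (\<forall>b\<in>W i. H (b, 1) = g b \<and> H (b, 0) \<in> A) \<and>
        (\<forall>c\<in>W i \<inter> C. \<forall>t\<in>{0..1}. H (c, t) = g c \<and> g c \<in> A)"
        unfolding strongly_relatively_inessential_def by metis
    qed
    then show ?thesis using that by (metis IntI)
  qed
  let ?T = "\<lambda>i. W i \<times> {0..1::real}"
  obtain G where G: "continuous_map (prod_topology (subtopology B ?V) ?J) X G"
    "\<And>p i. \<lbrakk>i \<in> I; p \<in> topspace (prod_topology (subtopology B ?V) ?J) \<inter> ?T i\<rbrakk> \<Longrightarrow> G p = H i p"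
  proof (rule pasting_lemma_exists[where X = "prod_topology (subtopology B ?V) ?J" and I = I
        and T = ?T and Y = X and f = H])
    show "topspace (prod_topology (subtopology B ?V) ?J) \<subseteq> (\<Union>i\<in>I. ?T i)" by auto
    show "openin (prod_topology (subtopology B ?V) ?J) (?T i)" if "i \<in> I" for i
    proof -
      have "openin (subtopology B ?V) (W i)"
        using W that by (auto simp: openin_subtopology)
      then show ?thesis by (simp add: openin_prod_Times_iff)
    qed
    show "continuous_map (subtopology (prod_topology (subtopology B ?V) ?J) (?T i)) X (H i)"
      if "i \<in> I" for i
    proof -
      have "?V \<inter> W i = W i" using that by blast
      then have "subtopology (prod_topology (subtopology B ?V) ?J) (?T i)
          = prod_topology (subtopology B (W i)) ?J"
        by (simp add: subtopology_Times subtopology_subtopology)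
      with H(1)[OF that] show ?thesis by simp
    qed
    show "H i x = H j x"
      if "i \<in> I" "j \<in> I" "x \<in> topspace (prod_topology (subtopology B ?V) ?J) \<inter> ?T i \<inter> ?T j" for i j x
    proof -
      have "i = j" using that dis by (auto simp: disjoint_family_on_def)
      then show ?thesis by simp
    qed
  qed (rule that)
  have GH: "G (b, t) = H i (b, t)" if "i \<in> I" "b \<in> W i" "t \<in> {0..1}" for i b t
    using G(2)[of i "(b, t)"] that sub by auto
  show ?thesis
    unfolding strongly_relatively_inessential_def
  proof (intro exI[of _ G] conjI ballI G(1))
    fix b assume "b \<in> topspace (subtopology B ?V)"
    then obtain i where "i \<in> I" "b \<in> W i" by auto
    then show "G (b, 1) = g b" "G (b, 0) \<in> A" using GH H(2) by auto
  next
    fix c and t :: real assume "c \<in> ?V \<inter> C" and t: "t \<in> {0..1}"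
    then obtain i where "i \<in> I" "c \<in> W i" "c \<in> C" by auto
    then show "G (c, t) = g c" "g c \<in> A" using GH H(3) t by auto
  qed
qed

section \<open>The cover of the product\<close>

lemma srel_cover_prod:
  fixes B1 :: "'a topology" and B2 :: "'b topology"
  assumes B1: "normal_space B1" and B2: "normal_space B2"
    and f1: "srel_cover B1 C1 X1 A1 f1 m" and f2: "srel_cover B2 C2 X2 A2 f2 n"
  shows "srel_cover (prod_topology B1 B2) (C1 \<times> C2) (prod_topology X1 X2) (A1 \<times> A2)
           (map_prod f1 f2) (m + n)"
proof -
  let ?B = "prod_topology B1 B2"
  obtain U where U: "\<And>i. i < Suc m \<Longrightarrow> openin B1 (U i)" "(\<Union>i<Suc m. U i) = topspace B1"
    "\<And>i. i < Suc m \<Longrightarrow> strongly_relatively_inessential (subtopology B1 (U i)) (U i \<inter> C1) X1 A1 f1"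
    using f1 unfolding srel_cover_def less_Suc_eq_le lessThan_Suc_atMost by blast
  obtain V where V: "\<And>j. j < Suc n \<Longrightarrow> openin B2 (V j)" "(\<Union>j<Suc n. V j) = topspace B2"
    "\<And>j. j < Suc n \<Longrightarrow> strongly_relatively_inessential (subtopology B2 (V j)) (V j \<inter> C2) X2 A2 f2"
    using f2 unfolding srel_cover_def less_Suc_eq_le lessThan_Suc_atMost by blast
  obtain \<phi> :: "nat \<Rightarrow> 'a \<Rightarrow> real"
    where \<phi>: "\<And>i. i < Suc m \<Longrightarrow> continuous_map B1 euclideanreal (\<phi> i)"
      "\<And>i x. i < Suc m \<Longrightarrow> x \<in> topspace B1 \<Longrightarrow> 0 \<le> \<phi> i x"
      "\<And>i x. i < Suc m \<Longrightarrow> x \<in> topspace B1 \<Longrightarrow> 0 < \<phi> i x \<Longrightarrow> x \<in> U i"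
      "\<And>x. x \<in> topspace B1 \<Longrightarrow> \<exists>i<Suc m. 0 < \<phi> i x"
    using normal_space_finite_cover_cozero[OF B1 U(1) equalityD2[OF U(2)]] by blast
  obtain \<psi> :: "nat \<Rightarrow> 'b \<Rightarrow> real"
    where \<psi>: "\<And>j. j < Suc n \<Longrightarrow> continuous_map B2 euclideanreal (\<psi> j)"
      "\<And>j y. j < Suc n \<Longrightarrow> y \<in> topspace B2 \<Longrightarrow> 0 \<le> \<psi> j y"
      "\<And>j y. j < Suc n \<Longrightarrow> y \<in> topspace B2 \<Longrightarrow> 0 < \<psi> j y \<Longrightarrow> y \<in> V j"
      "\<And>y. y \<in> topspace B2 \<Longrightarrow> \<exists>j<Suc n. 0 < \<psi> j y"
    using normal_space_finite_cover_cozero[OF B2 V(1) equalityD2[OF V(2)]] by blast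
  \<comment> \<open>The \<open>i\<close>-th interval of \<open>x\<close> runs from
    \<open>s i x\<close> to \<open>s (Suc i) x\<close>; likewise \<open>r\<close> gives the
    endpoints for \<open>y\<close>.\<close>
  define s where "s i x = (\<Sum>a<i. \<phi> a x)" for i x
  define r where "r j y = (\<Sum>b<j. \<psi> b y)" for j y
  have s_mono: "s i x \<le> s i' x" if "i \<le> i'" "i' \<le> Suc m" "x \<in> topspace B1" for i i' x
    unfolding s_def using that \<phi>(2) by (intro sum_mono2) auto
  have r_mono: "r j y \<le> r j' y" if "j \<le> j'" "j' \<le> Suc n" "y \<in> topspace B2" for j j' y
    unfolding r_def using that \<psi>(2) by (intro sum_mono2) auto
  \<comment> \<open>Smaller right end minus larger left end: the length of the overlap when
    positive. As a continuous function of \<open>p\<close> it makes \<open>W i j\<close>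
    open.\<close>
  define h where "h i j p = min (s (Suc i) (fst p)) (r (Suc j) (snd p))
      - max (s i (fst p)) (r j (snd p))" for i j p
  define W where "W i j = {p \<in> topspace ?B. h i j p \<in> {0<..}}" for i j
  have s_cont: "continuous_map ?B euclideanreal (\<lambda>p. s i (fst p))" if "i \<le> Suc m" for i
    unfolding s_def using that \<phi>(1)
    by (intro continuous_map_sum continuous_map_compose[OF continuous_map_fst, unfolded o_def]) auto
  have r_cont: "continuous_map ?B euclideanreal (\<lambda>p. r j (snd p))" if "j \<le> Suc n" for j
    unfolding r_def using that \<psi>(1)
    by (intro continuous_map_sum continuous_map_compose[OF continuous_map_snd, unfolded o_def]) auto
  have W_open: "openin ?B (W i j)" if "i \<le> m" "j \<le> n" for i j
  proof -
    have "continuous_map ?B euclideanreal (h i j)"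
      unfolding h_def using that
      by (intro continuous_map_diff continuous_map_real_min continuous_map_real_max
          s_cont r_cont) auto
    then show ?thesis
      unfolding W_def by (rule openin_continuous_map_preimage) simp
  qed
  \<comment> \<open>A positive overlap forces both intervals to have positive length, that is
    \<open>\<phi> i\<close> and \<open>\<psi> j\<close> are positive at the point.\<close>
  have W_sub: "W i j \<subseteq> U i \<times> V j" if "i \<le> m" "j \<le> n" for i j
    using that \<phi>(3) \<psi>(3) by (auto simp: W_def h_def s_def r_def)
  have W_dis: "W i j \<inter> W i' j' = {}" if "i < i'" "j' < j" "i' \<le> m" "j \<le> n" for i j i' j'
  proof -
    have "p \<notin> W i' j'" if p: "p \<in> W i j" for p
    proof
      assume p': "p \<in> W i' j'"
      \<comment> \<open>Lying in both sets would give, at \<open>p\<close>, the cycle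
        \<open>r j < s (Suc i) \<le> s i' < r (Suc j') \<le> r j\<close>.\<close>
      have "s (Suc i) (fst p) \<le> s i' (fst p)" "r (Suc j') (snd p) \<le> r j (snd p)"
        using p \<open>i < i'\<close> \<open>j' < j\<close> \<open>i' \<le> m\<close> \<open>j \<le> n\<close>
        by (auto simp: W_def intro!: s_mono r_mono)
      then show False using p p' by (auto simp: W_def h_def)
    qed
    then show ?thesis by blast
  qed
  have W_cov: "\<exists>i\<le>m. \<exists>j\<le>n. p \<in> W i j" if p: "p \<in> topspace ?B" for p
  proof -
    \<comment> \<open>Take the least \<open>i\<close> with \<open>\<phi> i\<close> positive: all
      earlier terms vanish, so this interval starts at 0.\<close>
    have "\<exists>i\<le>m. 0 < s (Suc i) (fst p) \<and> s i (fst p) = 0"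
    proof -
      obtain i where i: "i < Suc m" "0 < \<phi> i (fst p)" "\<And>a. a < i \<Longrightarrow> \<not> 0 < \<phi> a (fst p)"
      proof -
        have "\<exists>i. i < Suc m \<and> 0 < \<phi> i (fst p)" using \<phi>(4) p by auto
        from exists_least_iff[THEN iffD1, OF this] that show ?thesis by (meson less_trans)
      qed
      have "\<phi> a (fst p) = 0" if "a < i" for a
        using i(1,3) \<phi>(2)[of a "fst p"] that p by force
      with i show ?thesis by (intro exI[of _ i]) (auto simp: s_def)
    qed
    moreover have "\<exists>j\<le>n. 0 < r (Suc j) (snd p) \<and> r j (snd p) = 0"
    proof -
      obtain j where j: "j < Suc n" "0 < \<psi> j (snd p)" "\<And>b. b < j \<Longrightarrow> \<not> 0 < \<psi> b (snd p)"
      proof -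
        have "\<exists>j. j < Suc n \<and> 0 < \<psi> j (snd p)" using \<psi>(4) p by auto
        from exists_least_iff[THEN iffD1, OF this] that show ?thesis by (meson less_trans)
      qed
      have "\<psi> b (snd p) = 0" if "b < j" for b
        using j(1,3) \<psi>(2)[of b "snd p"] that p by force
      with j show ?thesis by (intro exI[of _ j]) (auto simp: r_def)
    qed
    ultimately show ?thesis using p unfolding W_def h_def by force
  qed
  have W_sri: "strongly_relatively_inessential (subtopology ?B (W i j)) (W i j \<inter> (C1 \<times> C2))
      (prod_topology X1 X2) (A1 \<times> A2) (map_prod f1 f2)" if "i \<le> m" "j \<le> n" for i j
  proof -
    \<comment> \<open>Regard \<open>W i j\<close> as a subspace of the box
      \<open>U i \<times> V j\<close>, where the product homotopy lives, and restrict.\<close>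
    have "subtopology ?B (W i j)
        = subtopology (prod_topology (subtopology B1 (U i)) (subtopology B2 (V j))) (W i j)"
      using W_sub[OF that]
      by (simp add: subtopology_subtopology inf.absorb2 flip: subtopology_Times)
    moreover have "W i j \<inter> (C1 \<times> C2) \<subseteq> (U i \<inter> C1) \<times> (V j \<inter> C2)"
      using W_sub[OF that] by auto
    moreover have "strongly_relatively_inessential
        (prod_topology (subtopology B1 (U i)) (subtopology B2 (V j))) ((U i \<inter> C1) \<times> (V j \<inter> C2))
        (prod_topology X1 X2) (A1 \<times> A2) (map_prod f1 f2)"
      using that by (intro strongly_relatively_inessential_prod U(3) V(3)) auto
    ultimately show ?thesis
      by (simp add: strongly_relatively_inessential_subtopology)
  qed
  define D where "D k = {(i, j). i \<le> m \<and> j \<le> n \<and> i + j = k}" for k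
  define Q where "Q k = (\<Union>c\<in>D k. case_prod W c)" for k
  show ?thesis
    unfolding srel_cover_def
  proof (intro exI[of _ Q] conjI allI impI)
    fix k
    show "openin ?B (Q k)"
      unfolding Q_def by (intro openin_Union) (auto simp: D_def W_open)
    have "disjoint_family_on (case_prod W) (D k)"
    proof (unfold disjoint_family_on_def, intro ballI impI)
      fix c d assume cd: "c \<in> D k" "d \<in> D k" "c \<noteq> d"
      obtain i j i' j' where ij: "c = (i, j)" "d = (i', j')" by fastforce
      \<comment> \<open>Two distinct pairs with the same sum differ in opposite directions in their
        two entries.\<close>
      then have "i < i' \<and> j' < j \<or> i' < i \<and> j < j'" "i \<le> m" "j \<le> n" "i' \<le> m" "j' \<le> n"
        using cd by (auto simp: D_def)
      then have "W i j \<inter> W i' j' = {}"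
        using W_dis[of i i' j' j] W_dis[of i' i j j'] by blast
      then show "case_prod W c \<inter> case_prod W d = {}"
        using ij by simp
    qed
    then show "strongly_relatively_inessential (subtopology ?B (Q k)) (Q k \<inter> (C1 \<times> C2))
      (prod_topology X1 X2) (A1 \<times> A2) (map_prod f1 f2)"
      unfolding Q_def
      by (intro strongly_relatively_inessential_disjoint_Union) (auto simp: D_def W_open W_sri)
  next
    show "(\<Union>k\<le>m + n. Q k) = topspace ?B"
    proof
      show "(\<Union>k\<le>m + n. Q k) \<subseteq> topspace ?B" by (auto simp: Q_def W_def)
      show "topspace ?B \<subseteq> (\<Union>k\<le>m + n. Q k)"
      proof
        fix p assume "p \<in> topspace ?B"
        then obtain i j where "i \<le> m" "j \<le> n" "p \<in> W i j" using W_cov by blast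
        then have "p \<in> Q (i + j)" "i + j \<le> m + n" by (auto simp: Q_def D_def)
        then show "p \<in> (\<Union>k\<le>m + n. Q k)" by blast
      qed
    qed
  qed
qed

section \<open>From covers to \<open>srelcat\<close>, and normality of the factors\<close>

lemma srelcat_le: "srel_cover B C X A f l \<Longrightarrow> srelcat B C X A f \<le> enat l"
  by (auto simp: srelcat_def intro: Least_le)

lemma srel_cover_srelcat: "srelcat B C X A f = enat l \<Longrightarrow> srel_cover B C X A f l"
  by (auto simp: srelcat_def intro: LeastI split: if_splits)

lemma srel_cover_empty:
  assumes "topspace B = {}"
  shows "srel_cover B C X A f l"
  unfolding srel_cover_def strongly_relatively_inessential_def
  using assms by (intro exI[of _ "\<lambda>_. {}"]) (auto simp: continuous_map_on_empty)

text \<open>Each factor is homeomorphic to a slice through a point of the other one. Points are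
  closed in a T1 space, so the slice is closed and inherits normality.\<close>

lemma normal_space_prod_topology_factors:
  assumes N: "normal_space (prod_topology X Y)" and "t1_space X" "t1_space Y"
    and x: "x \<in> topspace X" and y: "y \<in> topspace Y"
  shows "normal_space X" and "normal_space Y"
proof -
  have c: "closedin (prod_topology X Y) (topspace X \<times> {y})"
    "closedin (prod_topology X Y) ({x} \<times> topspace Y)"
    using assms by (auto simp: closedin_prod_Times_iff closedin_t1_singleton)
  have "subtopology (prod_topology X Y) (topspace X \<times> {y}) homeomorphic_space X"
    by (metis y homeomorphic_space_prod_topology_sing1 homeomorphic_space_sym
        prod_topology_subtopology(2))
  then show "normal_space X"
    using N c(1) homeomorphic_normal_space normal_space_closed_subtopology by blast
  have "subtopology (prod_topology X Y) ({x} \<times> topspace Y) homeomorphic_space Y"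
    by (metis x homeomorphic_space_prod_topology_sing2 homeomorphic_space_sym
        prod_topology_subtopology(1))
  then show "normal_space Y"
    using N c(2) homeomorphic_normal_space normal_space_closed_subtopology by blast
qed

lemma CW_pair_imp_t1_space: "CW_pair X A \<Longrightarrow> t1_space X"
  by (auto simp: CW_pair_def CW_structure_def Hausdorff_imp_t1_space)

theorem proposition2p16:
  fixes B1 :: "'a topology" and B2 :: "'b topology"
    and X1 :: "'c topology" and X2 :: "'d topology"
    and f1 :: "'a \<Rightarrow> 'c" and f2 :: "'b \<Rightarrow> 'd"
  assumes "CW_pair B1 C1" and "CW_pair B2 C2"
    and "CW_pair X1 A1" and "CW_pair X2 A2"
    and "map_of_pairs B1 C1 X1 A1 f1" and "map_of_pairs B2 C2 X2 A2 f2"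
    and "normal_space (prod_topology B1 B2)"
  shows "srelcat (prod_topology B1 B2) (C1 \<times> C2) (prod_topology X1 X2) (A1 \<times> A2) (map_prod f1 f2)
           \<le> srelcat B1 C1 X1 A1 f1 + srelcat B2 C2 X2 A2 f2"
proof (cases "srelcat B1 C1 X1 A1 f1 = \<infinity> \<or> srelcat B2 C2 X2 A2 f2 = \<infinity>")
  case True
  then show ?thesis by auto
next
  case False
  then obtain m n where mn: "srelcat B1 C1 X1 A1 f1 = enat m" "srelcat B2 C2 X2 A2 f2 = enat n"
    by auto
  have "srel_cover (prod_topology B1 B2) (C1 \<times> C2) (prod_topology X1 X2) (A1 \<times> A2)
      (map_prod f1 f2) (m + n)"
  \<comment> \<open>If one factor is empty, the product carries no slice of the other, whose
    normality then cannot be inferred; but any number of empty sets covers the empty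
    product.\<close>
  proof (cases "topspace (prod_topology B1 B2) = {}")
    case True
    then show ?thesis by (rule srel_cover_empty)
  next
    case False
    then obtain x y where "x \<in> topspace B1" "y \<in> topspace B2"
      unfolding topspace_prod_topology by blast
    then have "normal_space B1" "normal_space B2"
      using normal_space_prod_topology_factors[OF assms(7)
          CW_pair_imp_t1_space[OF assms(1)] CW_pair_imp_t1_space[OF assms(2)]]
      by blast+
    then show ?thesis by (intro srel_cover_prod srel_cover_srelcat mn)
  qed
  then show ?thesis using srelcat_le mn by fastforce
qed

end
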